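(* Let $n\ge 1$ and let $p_1(x),\dots,p_n(x)\in\mathbb{Q}[x]$ be non-constant polynomials that are pairwise relatively prime, i.e. $\gcd(p_i(x),p_j(x))=1$ whenever $i\ne j$. Then the following identity holds in $\mathbb{Q}(x)$: $$\frac{1}{p_1(x)\cdots p_n(x)}=\frac{k_1(x)}{p_1(x)}+\cdots+\frac{k_n(x)}{p_n(x)},\qquad k_i(x)=\mathrm{eval}\Big(\prod_{j=1,\,j\ne i}^{n}\frac{1}{p_j(x)};\ p_i(x)\Big)\quad(1\le i\le n).$$
   Context: For $f,p\in\mathbb{Q}[x]$ with $p\neq 0$, $f\ \mathrm{rem}\ p$ denotes the unique $r\in\mathbb{Q}[x]$ with $\deg r<\deg p$ and $f=pq+r$ for some $q\in\mathbb{Q}[x]$. For $r,s,a\in\mathbb{Q}[x]$ with $\gcd(s,a)=1$, the evaluation of the fraction $r/s$ modulo $a$ is the polynomial $\mathrm{eval}\big(\tfrac{r(x)}{s(x)};\,a(x)\big)=(\alpha(x)r(x))\ \mathrm{rem}\ a(x)$, where $\alpha\in\mathbb{Q}[x]$ is any polynomial with $\alpha(x)s(x)\equiv 1 \pmod{a(x)}$. *)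

theory Defs
  imports "HOL-Computational_Algebra.Computational_Algebra" "HOL-Computational_Algebra.Field_as_Ring"
    "HOL-Number_Theory.Cong"
begin

text \<open>The field \<open>\<rat>(x)\<close> is \<^typ>\<open>rat poly fract\<close>, the embedding of \<open>\<rat>[x]\<close> is \<^const>\<open>to_fract\<close>,
  and \<open>f rem p\<close> is \<open>f mod p\<close> on \<^typ>\<open>rat poly\<close>.

  Evaluation is defined on elements of \<open>\<rat>(x)\<close>: \<open>eval_mod_eq\<close> shows that the value does not depend
  on the choice of \<open>r\<close>, \<open>s\<close>, \<open>\<alpha>\<close>. It is unspecified if no presentation \<open>r/s\<close> of \<open>F\<close> has \<open>s\<close>
  coprime to \<open>a\<close>.\<close>

definition eval_mod :: "rat poly fract \<Rightarrow> rat poly \<Rightarrow> rat poly" where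
  "eval_mod F a = (THE y. \<exists>r s \<alpha>. s \<noteq> 0 \<and> F = Fract r s \<and> gcd s a = 1 \<and>
                          [\<alpha> * s = 1] (mod a) \<and> y = (\<alpha> * r) mod a)"

lemma eval_mod_eq:
  fixes r s a \<alpha> :: "rat poly"
  assumes "s \<noteq> 0" "gcd s a = 1" "[\<alpha> * s = 1] (mod a)"
  shows "eval_mod (Fract r s) a = (\<alpha> * r) mod a"
  unfolding eval_mod_def
proof (rule the_equality)
  show "\<exists>r' s' \<alpha>'. s' \<noteq> 0 \<and> Fract r s = Fract r' s' \<and> gcd s' a = 1 \<and>
          [\<alpha>' * s' = 1] (mod a) \<and> \<alpha> * r mod a = (\<alpha>' * r') mod a"
    by (intro exI conjI; (rule assms refl)?)
next
  fix y
  assume "\<exists>r' s' \<alpha>'. s' \<noteq> 0 \<and> Fract r s = Fract r' s' \<and> gcd s' a = 1 \<and>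
            [\<alpha>' * s' = 1] (mod a) \<and> y = (\<alpha>' * r') mod a"
  then obtain r' s' \<beta> where *: "s' \<noteq> 0" "Fract r s = Fract r' s'"
      "[\<beta> * s' = 1] (mod a)" "y = (\<beta> * r') mod a"
    by (elim exE conjE)
  have rs: "r * s' = r' * s"
    using *(2) by (simp only: eq_fract(1)[OF assms(1) *(1)])
  have "[(\<alpha> * s) * (\<beta> * r') = 1 * (\<beta> * r')] (mod a)"
    by (rule cong_mult[OF assms(3) cong_refl])
  moreover have "[(\<beta> * s') * (\<alpha> * r) = 1 * (\<alpha> * r)] (mod a)"
    by (rule cong_mult[OF *(3) cong_refl])
  moreover have "(\<alpha> * s) * (\<beta> * r') = (\<beta> * s') * (\<alpha> * r)"
  proof -
    have "(\<alpha> * s) * (\<beta> * r') = \<alpha> * \<beta> * (r' * s)"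
      by (simp only: ac_simps)
    also have "\<dots> = (\<beta> * s') * (\<alpha> * r)"
      unfolding rs[symmetric] by (simp only: ac_simps)
    finally show ?thesis .
  qed
  ultimately show "y = (\<alpha> * r) mod a"
    using *(4) unfolding cong_def by simp
qed

lemma eval_mod_inverse_exists:
  fixes s a :: "rat poly"
  assumes "gcd s a = 1"
  shows "\<exists>\<alpha>. [\<alpha> * s = 1] (mod a)"
proof -
  let ?u = "fst (bezout_coefficients s a)" and ?v = "snd (bezout_coefficients s a)"
  have "?u * s + ?v * a = 1"
    using assms by (simp only: bezout_coefficients_fst_snd)
  then have "?u * s mod a = 1 mod a"
    using mod_mult_self1[of "?u * s" ?v a] by (simp only:)
  then show ?thesis
    unfolding cong_def by (rule exI)
qed

end

theory Submission
  imports Defs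
begin

text \<open>With \<open>P\<close> the product of all \<open>p\<^sub>i\<close>, the polynomial \<open>\<Sum>i. k\<^sub>i (P / p\<^sub>i) - 1\<close> vanishes modulo each
  \<open>p\<^sub>i\<close>, hence modulo \<open>P\<close> by coprimality. Its degree is less than that of \<open>P\<close>, so it is zero.\<close>

lemma to_fract_prod:
  "to_fract (\<Prod>i\<in>A. f i) = (\<Prod>i\<in>A. to_fract (f i))"
  by (induction A rule: infinite_finite_induct) simp_all

text \<open>This is the partial fraction identity with denominators cleared. Only two properties of
  the values of \<open>eval_mod\<close> enter: each is reduced modulo \<open>p i\<close>, and each
  inverts the complementary product there.\<close>

lemma sum_mult_cofactors_eq_1:
  fixes p k :: "'i \<Rightarrow> 'a :: field_gcd poly"
  assumes fin: "finite I" and ne: "I \<noteq> {}"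
    and cop: "\<And>i j. i \<in> I \<Longrightarrow> j \<in> I \<Longrightarrow> i \<noteq> j \<Longrightarrow> coprime (p i) (p j)"
    and deg: "\<And>i. i \<in> I \<Longrightarrow> degree (k i) < degree (p i)"
    and cong: "\<And>i. i \<in> I \<Longrightarrow> [k i * (\<Prod>j\<in>I - {i}. p j) = 1] (mod p i)"
  shows "(\<Sum>i\<in>I. k i * (\<Prod>j\<in>I - {i}. p j)) = 1"
proof -
  define P where "P = (\<Prod>i\<in>I. p i)"
  define c where "c i = (\<Prod>j\<in>I - {i}. p j)" for i
  define D where "D = (\<Sum>i\<in>I. k i * c i) - 1"
  have p_nz: "p i \<noteq> 0" if "i \<in> I" for i
    using deg[OF that] by auto
  have P_nz: "P \<noteq> 0"
    using fin p_nz by (simp add: P_def)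
  have P_eq: "P = p i * c i" if "i \<in> I" for i
    unfolding P_def c_def using fin that by (rule prod.remove)
  \<comment> \<open>Compare with \<open>P = p i * c i\<close>: the factor \<open>p i\<close> is
    replaced by \<open>k i\<close>, of smaller degree.\<close>
  have deg_summand: "degree (k i * c i) < degree P" if "i \<in> I" for i
  proof -
    have "degree P = degree (p i) + degree (c i)"
      using P_nz P_eq[OF that] by (metis degree_mult_eq mult_eq_0_iff)
    with degree_mult_le[of "k i" "c i"] deg[OF that] show ?thesis
      by linarith
  qed
  \<comment> \<open>Any one summand witnesses this, as \<open>I\<close> is nonempty. It puts the
    constant 1 in \<open>D\<close> below the degree bound too.\<close>
  have pos: "degree P > 0"
    using ne deg_summand by fastforce
  have "degree (\<Sum>i\<in>I. k i * c i) < degree P"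
    using pos deg_summand by (intro degree_sum_less)
  with pos have "degree D < degree P"
    unfolding D_def by (intro degree_diff_less) simp_all
  moreover have "[(\<Sum>i\<in>I. k i * c i) = 1] (mod P)"
    unfolding P_def
  proof (intro cong_cong_prod_coprime ballI impI)
    fix i assume i: "i \<in> I"
    \<comment> \<open>Modulo \<open>p i\<close> only the summand with index \<open>i\<close>
      survives, since every other cofactor contains \<open>p i\<close>.\<close>
    have "p i dvd c j" if "j \<in> I - {i}" for j
      unfolding c_def using fin i that by (intro dvd_prodI) auto
    then have "p i dvd (\<Sum>j\<in>I - {i}. k j * c j)"
      by (intro dvd_sum dvd_mult)
    then have "[k i * c i + (\<Sum>j\<in>I - {i}. k j * c j) = 1 + 0] (mod p i)"
      using cong[OF i] by (intro cong_add) (simp_all add: c_def cong_0_iff)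
    then show "[(\<Sum>i\<in>I. k i * c i) = 1] (mod p i)"
      by (simp add: sum.remove[OF fin i])
  qed (rule cop)
  then have "P dvd D"
    by (simp add: cong_iff_dvd_diff D_def)
  \<comment> \<open>A nonzero multiple of \<open>P\<close> would have degree at least
    \<open>degree P\<close>.\<close>
  ultimately have "D = 0"
    using dvd_imp_degree_le[of P D] by fastforce
  then show ?thesis
    by (simp add: D_def c_def)
qed

theorem theorem3p13:
  fixes n :: nat and p :: "nat \<Rightarrow> rat poly" and k :: "nat \<Rightarrow> rat poly"
  assumes "n \<ge> 1"
    and "\<And>i. i \<in> {1..n} \<Longrightarrow> degree (p i) > 0"
    and "\<And>i j. i \<in> {1..n} \<Longrightarrow> j \<in> {1..n} \<Longrightarrow> i \<noteq> j \<Longrightarrow> gcd (p i) (p j) = 1"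
    and "\<And>i. i \<in> {1..n} \<Longrightarrow> k i = eval_mod (\<Prod>j\<in>{1..n} - {i}. 1 / to_fract (p j)) (p i)"
  shows "1 / (\<Prod>i = 1..n. to_fract (p i)) = (\<Sum>i = 1..n. to_fract (k i) / to_fract (p i))"
proof -
  define c where "c i = (\<Prod>j\<in>{1..n} - {i}. p j)" for i
  have p_nz: "p i \<noteq> 0" if "i \<in> {1..n}" for i
    using assms(2)[OF that] by auto
  have c_nz: "c i \<noteq> 0" for i
    using p_nz by (simp add: c_def)
  have cop: "coprime (p i) (p j)" if "i \<in> {1..n}" "j \<in> {1..n}" "i \<noteq> j" for i j
    using assms(3)[OF that] by (simp add: coprime_iff_gcd_eq_1)
  have k: "degree (k i) < degree (p i) \<and> [k i * c i = 1] (mod p i)" if i: "i \<in> {1..n}" for i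
  proof -
    have "coprime (c i) (p i)"
      unfolding c_def using i cop by (intro prod_coprime_left) auto
    then have gcd: "gcd (c i) (p i) = 1"
      by (simp add: coprime_iff_gcd_eq_1)
    then obtain \<alpha> where \<alpha>: "[\<alpha> * c i = 1] (mod p i)"
      using eval_mod_inverse_exists[OF gcd] by (elim exE)
    \<comment> \<open>This presentation has a denominator coprime to \<open>p i\<close>, so
      \<open>eval_mod\<close> returns the inverse \<alpha> of \<open>c i\<close>, reduced modulo
      \<open>p i\<close>.\<close>
    have "(\<Prod>j\<in>{1..n} - {i}. 1 / to_fract (p j)) = Fract 1 (c i)"
      by (simp add: prod_dividef Fract_conv_to_fract c_def to_fract_prod)
    then have k_eq: "k i = \<alpha> mod p i"
      using assms(4)[OF i] eval_mod_eq[OF c_nz gcd \<alpha>, of 1] by simp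
    with \<alpha> have "[k i * c i = 1] (mod p i)"
      by (simp add: cong_def mod_mult_left_eq)
    \<comment> \<open>A zero remainder has degree 0 by convention; there the bound comes from
      \<open>p i\<close> being non-constant.\<close>
    moreover have "degree (k i) < degree (p i)"
      using degree_mod_less'[OF p_nz[OF i], of \<alpha>] assms(2)[OF i] k_eq by (cases "k i = 0") auto
    ultimately show ?thesis by blast
  qed
  have "(\<Sum>i = 1..n. k i * c i) = 1"
    unfolding c_def using assms(1) cop k
    by (intro sum_mult_cofactors_eq_1) (auto simp: c_def)
  then have "1 = (\<Sum>i = 1..n. to_fract (k i) * to_fract (c i))"
    by (metis (no_types, lifting) sum.cong to_fract_1 to_fract_mult to_fract_sum)
  then have "1 / (\<Prod>i = 1..n. to_fract (p i)) =
      (\<Sum>i = 1..n. to_fract (k i) * to_fract (c i) / (\<Prod>j = 1..n. to_fract (p j)))"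
    by (simp flip: sum_divide_distrib)
  also have "\<dots> = (\<Sum>i = 1..n. to_fract (k i) / to_fract (p i))"
  proof (rule sum.cong)
    fix i assume i: "i \<in> {1..n}"
    \<comment> \<open>Splitting off the factor \<open>p i\<close> lets the nonzero
      \<open>c i\<close> cancel.\<close>
    have "(\<Prod>j = 1..n. to_fract (p j)) = to_fract (p i) * to_fract (c i)"
      unfolding c_def to_fract_prod by (rule prod.remove) (use i in auto)
    then show "to_fract (k i) * to_fract (c i) / (\<Prod>j = 1..n. to_fract (p j)) = to_fract (k i) / to_fract (p i)"
      using c_nz[of i] by simp
  qed simp
  finally show ?thesis .
qed

end
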